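(* Let $\varphi$ be a smooth positive function of the length, let $c:S^1_\ell\to\mathbb{R}^2$ be a smooth free immersion of length $\ell$ parametrized by arclength, and let $m,h\in C^\infty(S^1_\ell,\mathbb{R})$ satisfy $\varphi(\ell)\|m\|^2=\varphi(\ell)\|h\|^2=1$ and $\langle m,h\rangle=0$. Then the sectional curvature of $G^\varphi$ on $B_{i,f}(S^1,\mathbb{R}^2)$ at $C=\pi(c)$ along the plane $P(m,h)$ is $$k_c(P(m,h))=\frac{\varphi}{2}\|m'h-mh'\|^2-\frac{\varphi'}{2\varphi}\left(\|m'\|^2+\|h'\|^2\right)+\frac{\varphi'}{4\varphi}\left(\|m\kappa_c\|^2+\|h\kappa_c\|^2\right)+\frac{3\varphi'^2-2\varphi\varphi''}{4\varphi^2}\left(\langle m,\kappa_c\rangle^2+\langle h,\kappa_c\rangle^2\right)-\frac{\varphi'^2}{4\varphi^3}\|\kappa_c\|^2,$$ where $\varphi,\varphi',\varphi''$ are evaluated at $\ell$ (with $\varphi'=d\varphi/d\ell$, $\varphi''=d^2\varphi/d\ell^2$), and $m'=dm/d\theta$, $h'=dh/d\theta$.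
   Context: $Imm(S^1,\mathbb{R}^2)$ is the space of $C^\infty$ immersions $S^1\to\mathbb{R}^2$; $Imm_f(S^1,\mathbb{R}^2)$ is the subspace of free immersions (those with trivial stabilizer under reparametrization by $Diff(S^1)$), and $B_{i,f}(S^1,\mathbb{R}^2)=Imm_f(S^1,\mathbb{R}^2)/Diff(S^1)$ with projection $\pi$. The metric $G^\varphi$ on $B_{i,f}$ is induced from $G^{\varphi}_c(h,k)=\varphi(\ell(c))\int_{S^1}(h\cdot k)|c_\theta|\,d\theta$ on $Imm_f$ by taking components normal to the curve. $S^1_\ell$ is the circle of length $\ell$, $c'$ is the derivative in arclength $\theta$, $n_c=ic'$ is the unit normal (with $\mathbb{R}^2=\mathbb{C}$), $\langle u,v\rangle=\int_{S^1_\ell}uv\,d\theta$, $\|u\|^2=\langle u,u\rangle$. A local chart of $B_{i,f}$ centered at $C=\pi(c)$ is $f\mapsto\pi(c+fn_c)$ for small $f\in C^\infty(S^1_\ell,(-\epsilon,\epsilon))$, so tangent vectors at $C$ are identified with functions $h\in C^\infty(S^1_\ell,\mathbb{R})$ (normal fields $hn_c$). In this chart the metric is $$G^\varphi_f(h,k)=\varphi(\ell_f)\int_{S^1_\ell}\frac{(1-f\kappa_c)^2hk}{\sqrt{(1-f\kappa_c)^2+f'^2}}\,d\theta,\qquad \ell_f=\int_{S^1_\ell}\sqrt{(1-f\kappa_c)^2+f'^2}\,d\theta,$$ where $\kappa_c$ is the curvature of $c$, defined by $c''=\kappa_c n_c$. $P(m,h)$ is the tangent plane at $C$ spanned by $m,h$.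 For $m,h$ orthonormal for $G^\varphi_0$, the sectional curvature is $$k_c(P(m,h))=d_md_hG_0^\varphi(h,m)-\tfrac12\left[d_md_mG_0^\varphi(h,h)+d_hd_hG_0^\varphi(m,m)\right]+G_0^\varphi(\Gamma_0(h,m),\Gamma_0(h,m))-G_0^\varphi(\Gamma_0(m,m),\Gamma_0(h,h)),$$ where $d_j$ denotes the directional derivative with respect to $f$ in direction $j$, the subscript $0$ means evaluation at $f=0$, and $\Gamma$ is determined by $2G_f^\varphi(\Gamma_f(h,k),j)=d_jG_f^\varphi(h,k)-d_hG_f^\varphi(k,j)-d_kG_f^\varphi(h,j)$ for all $j$. *)

theory Defs
  imports "HOL-Analysis.Analysis"
begin

text \<open>
  The plane is identified with \<^typ>\<open>complex\<close>. Functions on the circle \<open>S\<^sup>1\<^sub>l\<close> of length \<open>l > 0\<close> are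
  represented by \<open>l\<close>-periodic functions on the real line, and diffeomorphisms of \<open>S\<^sup>1\<^sub>l\<close> by their lifts.
\<close>

subsection \<open>Smooth functions on the circle\<close>

text \<open>The set \<open>S\<close> is meant to be open: the derivatives are two-sided.\<close>

definition smooth_on :: "real set \<Rightarrow> (real \<Rightarrow> 'a::real_normed_vector) \<Rightarrow> bool" where
  "smooth_on S u \<longleftrightarrow>
     (\<forall>n::nat. \<forall>t\<in>S. ((\<lambda>v t. vector_derivative v (at t)) ^^ n) u differentiable (at t))"

definition circle_smooth :: "real \<Rightarrow> (real \<Rightarrow> 'a::real_normed_vector) set" where
  "circle_smooth l = {u. smooth_on UNIV u \<and> (\<forall>t. u (t + l) = u t)}"

definition circle_inner :: "real \<Rightarrow> (real \<Rightarrow> real) \<Rightarrow> (real \<Rightarrow> real) \<Rightarrow> real" where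
  "circle_inner l u v = integral {0..l} (\<lambda>\<theta>. u \<theta> * v \<theta>)"

definition circle_norm :: "real \<Rightarrow> (real \<Rightarrow> real) \<Rightarrow> real" where
  "circle_norm l u = sqrt (circle_inner l u u)"

subsection \<open>Free immersions\<close>

definition immersion :: "real \<Rightarrow> (real \<Rightarrow> complex) \<Rightarrow> bool" where
  "immersion l c \<longleftrightarrow> c \<in> circle_smooth l \<and> (\<forall>t. vector_derivative c (at t) \<noteq> 0)"

text \<open>The two signs are the orientation preserving and the orientation reversing diffeomorphisms.\<close>

definition circle_diffeo :: "real \<Rightarrow> (real \<Rightarrow> real) \<Rightarrow> bool" where
  "circle_diffeo l \<psi> \<longleftrightarrow>
     bij \<psi> \<and> smooth_on UNIV \<psi> \<and> smooth_on UNIV (inv \<psi>) \<and>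
     ((\<forall>t. \<psi> (t + l) = \<psi> t + l) \<or> (\<forall>t. \<psi> (t + l) = \<psi> t - l))"

text \<open>A lift induces the identity of the circle iff it is the translation by a multiple of \<open>l\<close>.\<close>

definition free_immersion :: "real \<Rightarrow> (real \<Rightarrow> complex) \<Rightarrow> bool" where
  "free_immersion l c \<longleftrightarrow> immersion l c \<and>
     (\<forall>\<psi>. circle_diffeo l \<psi> \<and> c \<circ> \<psi> = c \<longrightarrow> (\<exists>k::int. \<forall>t. \<psi> t = t + of_int k * l))"

definition arclength_param :: "(real \<Rightarrow> complex) \<Rightarrow> bool" where
  "arclength_param c \<longleftrightarrow> (\<forall>t. norm (vector_derivative c (at t)) = 1)"

definition unit_normal :: "(real \<Rightarrow> complex) \<Rightarrow> real \<Rightarrow> complex" where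
  "unit_normal c \<theta> = \<i> * sgn (vector_derivative c (at \<theta>))"

text \<open>Only meaningful for curves parametrized by arclength (see \<open>curvature_works\<close> below).\<close>

definition curvature :: "(real \<Rightarrow> complex) \<Rightarrow> real \<Rightarrow> real" where
  "curvature c \<theta> =
     (THE k. vector_derivative (\<lambda>t. vector_derivative c (at t)) (at \<theta>) = k *\<^sub>R unit_normal c \<theta>)"

definition curve_length :: "real \<Rightarrow> (real \<Rightarrow> complex) \<Rightarrow> real" where
  "curve_length l c = integral {0..l} (\<lambda>\<theta>. norm (vector_derivative c (at \<theta>)))"

subsection \<open>The metric on immersions and on shapes\<close>

definition metric_imm ::
  "(real \<Rightarrow> real) \<Rightarrow> real \<Rightarrow> (real \<Rightarrow> complex) \<Rightarrow> (real \<Rightarrow> complex) \<Rightarrow> (real \<Rightarrow> complex) \<Rightarrow> real" where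
  "metric_imm \<phi> l c h k =
     \<phi> (curve_length l c) *
     integral {0..l} (\<lambda>\<theta>. (h \<theta> \<bullet> k \<theta>) * norm (vector_derivative c (at \<theta>)))"

definition normal_part :: "(real \<Rightarrow> complex) \<Rightarrow> (real \<Rightarrow> complex) \<Rightarrow> real \<Rightarrow> complex" where
  "normal_part c h \<theta> = (h \<theta> \<bullet> unit_normal c \<theta>) *\<^sub>R unit_normal c \<theta>"

text \<open>
  The induced metric on the quotient by reparametrizations: a vector field along \<open>c\<close> represents a
  tangent vector at the class of \<open>c\<close>, and only its component normal to \<open>c\<close> counts.
\<close>

definition metric_shape ::
  "(real \<Rightarrow> real) \<Rightarrow> real \<Rightarrow> (real \<Rightarrow> complex) \<Rightarrow> (real \<Rightarrow> complex) \<Rightarrow> (real \<Rightarrow> complex) \<Rightarrow> real" where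
  "metric_shape \<phi> l c h k = metric_imm \<phi> l c (normal_part c h) (normal_part c k)"

definition chart :: "(real \<Rightarrow> complex) \<Rightarrow> (real \<Rightarrow> real) \<Rightarrow> real \<Rightarrow> complex" where
  "chart c f \<theta> = c \<theta> + f \<theta> *\<^sub>R unit_normal c \<theta>"

text \<open>
  The metric in the chart centered at \<open>c\<close>. The derivative of the chart at \<open>f\<close> in direction \<open>h\<close> is the
  field \<open>h n\<^sub>c\<close> along \<^term>\<open>chart c f\<close>, which in general is not normal to that curve. The resulting
  coordinate expression is the lemma \<open>metric_chart_eq\<close> below.
\<close>

definition metric_chart ::
  "(real \<Rightarrow> real) \<Rightarrow> real \<Rightarrow> (real \<Rightarrow> complex) \<Rightarrow> (real \<Rightarrow> real) \<Rightarrow> (real \<Rightarrow> real) \<Rightarrow> (real \<Rightarrow> real) \<Rightarrow> real" where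
  "metric_chart \<phi> l c f h k =
     metric_shape \<phi> l (chart c f)
       (\<lambda>\<theta>. h \<theta> *\<^sub>R unit_normal c \<theta>) (\<lambda>\<theta>. k \<theta> *\<^sub>R unit_normal c \<theta>)"

subsection \<open>Sectional curvature in the chart\<close>

definition dir_deriv ::
  "(real \<Rightarrow> real) \<Rightarrow> ((real \<Rightarrow> real) \<Rightarrow> real) \<Rightarrow> (real \<Rightarrow> real) \<Rightarrow> real" where
  "dir_deriv j F f = deriv (\<lambda>t. F (\<lambda>\<theta>. f \<theta> + t * j \<theta>)) 0"

text \<open>Note the sign convention: this is the negative of the usual Christoffel symbol.\<close>

definition christoffel ::
  "(real \<Rightarrow> real) \<Rightarrow> real \<Rightarrow> (real \<Rightarrow> complex) \<Rightarrow> (real \<Rightarrow> real) \<Rightarrow> (real \<Rightarrow> real) \<Rightarrow> (real \<Rightarrow> real) \<Rightarrow>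
   real \<Rightarrow> real" where
  "christoffel \<phi> l c f h k =
     (THE g. g \<in> circle_smooth l \<and>
        (\<forall>j\<in>circle_smooth l.
           2 * metric_chart \<phi> l c f g j =
             dir_deriv j (\<lambda>f. metric_chart \<phi> l c f h k) f
             - dir_deriv h (\<lambda>f. metric_chart \<phi> l c f k j) f
             - dir_deriv k (\<lambda>f. metric_chart \<phi> l c f h j) f))"

text \<open>For \<open>m\<close>, \<open>h\<close> orthonormal with respect to the metric at the center of the chart.\<close>

definition sectional_curvature ::
  "(real \<Rightarrow> real) \<Rightarrow> real \<Rightarrow> (real \<Rightarrow> complex) \<Rightarrow> (real \<Rightarrow> real) \<Rightarrow> (real \<Rightarrow> real) \<Rightarrow> real" where
  "sectional_curvature \<phi> l c m h =
     (let G = metric_chart \<phi> l c; o0 = (\<lambda>\<theta>. 0); \<Gamma> = christoffel \<phi> l c o0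
      in dir_deriv m (dir_deriv h (\<lambda>f. G f h m)) o0
         - (1/2) * (dir_deriv m (dir_deriv m (\<lambda>f. G f h h)) o0
                    + dir_deriv h (dir_deriv h (\<lambda>f. G f m m)) o0)
         + G o0 (\<Gamma> h m) (\<Gamma> h m)
         - G o0 (\<Gamma> m m) (\<Gamma> h h))"

subsection \<open>The metric in coordinates\<close>

lemma smooth_on_derivs:
  assumes "smooth_on UNIV u"
  shows "(u has_vector_derivative vector_derivative u (at t)) (at t)"
    and "((\<lambda>t. vector_derivative u (at t)) has_vector_derivative
          vector_derivative (\<lambda>t. vector_derivative u (at t)) (at t)) (at t)"
proof -
  have "((\<lambda>v t. vector_derivative v (at t)) ^^ n) u differentiable (at t)" for n
    using assms by (simp add: smooth_on_def)
  from this[of 0] this[of 1]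
  show "(u has_vector_derivative vector_derivative u (at t)) (at t)"
    and "((\<lambda>t. vector_derivative u (at t)) has_vector_derivative
          vector_derivative (\<lambda>t. vector_derivative u (at t)) (at t)) (at t)"
    by (simp_all add: vector_derivative_works)
qed

lemma unit_normal_arclength:
  assumes "arclength_param c"
  shows "unit_normal c \<theta> = \<i> * vector_derivative c (at \<theta>)"
  using assms by (simp add: unit_normal_def arclength_param_def sgn_div_norm)

lemma curvature_works:
  assumes "smooth_on UNIV c" "arclength_param c"
  shows "vector_derivative (\<lambda>t. vector_derivative c (at t)) (at \<theta>)
         = curvature c \<theta> *\<^sub>R unit_normal c \<theta>"
proof -
  define v where "v = (\<lambda>t. vector_derivative c (at t))"
  define a where "a = vector_derivative v (at \<theta>)"
  have nv: "norm (v t) = 1" for t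
    using assms(2) by (simp add: arclength_param_def v_def)
  have vd: "(v has_vector_derivative a) (at \<theta>)"
    using smooth_on_derivs(2)[OF assms(1)] by (simp add: v_def a_def)
  have "((\<lambda>t. v t \<bullet> v t) has_vector_derivative (v \<theta> \<bullet> a + a \<bullet> v \<theta>)) (at \<theta>)"
    by (rule bounded_bilinear.has_vector_derivative[OF bounded_bilinear_inner vd vd])
  moreover have "(\<lambda>t. v t \<bullet> v t) = (\<lambda>t. 1)"
    using nv by (simp add: dot_square_norm)
  ultimately have "((\<lambda>t::real. 1::real) has_vector_derivative (v \<theta> \<bullet> a + a \<bullet> v \<theta>)) (at \<theta>)"
    by simp
  then have "v \<theta> \<bullet> a + a \<bullet> v \<theta> = 0"
    using vector_derivative_unique_at[OF _ has_vector_derivative_const] by blast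
  then have orth: "Re (v \<theta>) * Re a + Im (v \<theta>) * Im a = 0"
    by (simp add: inner_complex_def algebra_simps)
  have one: "Re (v \<theta>) * Re (v \<theta>) + Im (v \<theta>) * Im (v \<theta>) = 1"
    using nv[of \<theta>] by (simp add: norm_complex_def power2_eq_square)
  have n: "unit_normal c \<theta> = \<i> * v \<theta>"
    using unit_normal_arclength[OF assms(2)] by (simp add: v_def)
  define k where "k = Re (v \<theta>) * Im a - Im (v \<theta>) * Re a"
  have "Re a = - (k * Im (v \<theta>))" "Im a = k * Re (v \<theta>)"
    using orth one unfolding k_def by algebra+
  then have ak: "a = k *\<^sub>R unit_normal c \<theta>"
    by (simp add: n complex_eq_iff)
  have "unit_normal c \<theta> \<noteq> 0"
    using n nv[of \<theta>] by auto
  then have "\<exists>!k. a = k *\<^sub>R unit_normal c \<theta>"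
    using ak by (metis scaleR_cancel_right)
  from theI'[OF this] show ?thesis
    by (simp add: curvature_def a_def v_def)
qed

lemma chart_has_vector_derivative:
  assumes "smooth_on UNIV c" "arclength_param c" "smooth_on UNIV f"
  shows "(chart c f has_vector_derivative
           (1 - f \<theta> * curvature c \<theta>) *\<^sub>R vector_derivative c (at \<theta>)
           + deriv f \<theta> *\<^sub>R unit_normal c \<theta>) (at \<theta>)"
proof -
  define v where "v = (\<lambda>t. vector_derivative c (at t))"
  have n: "unit_normal c t = \<i> * v t" for t
    using unit_normal_arclength[OF assms(2)] by (simp add: v_def)
  have cd: "(c has_vector_derivative v \<theta>) (at \<theta>)"
    using smooth_on_derivs(1)[OF assms(1)] by (simp add: v_def)
  have vd: "(v has_vector_derivative curvature c \<theta> *\<^sub>R (\<i> * v \<theta>)) (at \<theta>)"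
    using smooth_on_derivs(2)[OF assms(1), of \<theta>] curvature_works[OF assms(1,2), of \<theta>]
    by (simp add: v_def n[unfolded v_def])
  have fd: "(f has_vector_derivative deriv f \<theta>) (at \<theta>)"
  proof -
    have "(f has_real_derivative vector_derivative f (at \<theta>)) (at \<theta>)"
      using smooth_on_derivs(1)[OF assms(3)]
      by (simp add: has_real_derivative_iff_has_vector_derivative)
    then show ?thesis
      by (simp add: DERIV_imp_deriv has_real_derivative_iff_has_vector_derivative)
  qed
  have "((\<lambda>t. c t + f t *\<^sub>R (\<i> * v t)) has_vector_derivative
          v \<theta> + (f \<theta> *\<^sub>R (\<i> * (curvature c \<theta> *\<^sub>R (\<i> * v \<theta>))) + deriv f \<theta> *\<^sub>R (\<i> * v \<theta>))) (at \<theta>)"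
    by (intro has_vector_derivative_add cd has_vector_derivative_mult_right vd
        bounded_bilinear.has_vector_derivative[OF bounded_bilinear_scaleR fd])
  moreover have "chart c f = (\<lambda>t. c t + f t *\<^sub>R (\<i> * v t))"
    by (simp add: chart_def fun_eq_iff n)
  moreover have "v \<theta> + (f \<theta> *\<^sub>R (\<i> * (curvature c \<theta> *\<^sub>R (\<i> * v \<theta>))) + deriv f \<theta> *\<^sub>R (\<i> * v \<theta>))
      = (1 - f \<theta> * curvature c \<theta>) *\<^sub>R v \<theta> + deriv f \<theta> *\<^sub>R unit_normal c \<theta>"
    by (simp add: n complex_eq_iff algebra_simps)
  ultimately show ?thesis
    by (simp add: v_def)
qed

lemma chart_speed:
  assumes "smooth_on UNIV c" "arclength_param c" "smooth_on UNIV f"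
  shows "norm (vector_derivative (chart c f) (at \<theta>))
         = sqrt ((1 - f \<theta> * curvature c \<theta>)\<^sup>2 + (deriv f \<theta>)\<^sup>2)"
proof -
  define v where "v = vector_derivative c (at \<theta>)"
  define p where "p = 1 - f \<theta> * curvature c \<theta>"
  define q where "q = deriv f \<theta>"
  have one: "(Re v)\<^sup>2 + (Im v)\<^sup>2 = 1"
    using assms(2) by (metis arclength_param_def cmod_power2 one_power2 v_def)
  have "vector_derivative (chart c f) (at \<theta>) = p *\<^sub>R v + q *\<^sub>R (\<i> * v)"
    using vector_derivative_at[OF chart_has_vector_derivative[OF assms]]
    by (simp add: unit_normal_arclength[OF assms(2)] v_def p_def q_def)
  moreover have "(p * Re v - q * Im v)\<^sup>2 + (p * Im v + q * Re v)\<^sup>2 = p\<^sup>2 + q\<^sup>2"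
    using one by algebra
  ultimately show ?thesis
    by (simp add: norm_complex_def p_def q_def)
qed

theorem curve_length_chart_eq:
  assumes "smooth_on UNIV c" "arclength_param c" "smooth_on UNIV f"
  shows "curve_length l (chart c f)
         = integral {0..l} (\<lambda>\<theta>. sqrt ((1 - f \<theta> * curvature c \<theta>)\<^sup>2 + (deriv f \<theta>)\<^sup>2))"
  by (simp add: curve_length_def chart_speed[OF assms])

theorem metric_chart_eq:
  assumes "smooth_on UNIV c" "arclength_param c" "smooth_on UNIV f"
  shows "metric_chart \<phi> l c f h k =
    \<phi> (integral {0..l} (\<lambda>\<theta>. sqrt ((1 - f \<theta> * curvature c \<theta>)\<^sup>2 + (deriv f \<theta>)\<^sup>2))) *
    integral {0..l} (\<lambda>\<theta>. (1 - f \<theta> * curvature c \<theta>)\<^sup>2 * h \<theta> * k \<theta>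
                          / sqrt ((1 - f \<theta> * curvature c \<theta>)\<^sup>2 + (deriv f \<theta>)\<^sup>2))"
proof -
  have "(normal_part (chart c f) (\<lambda>\<theta>. h \<theta> *\<^sub>R unit_normal c \<theta>) \<theta>
         \<bullet> normal_part (chart c f) (\<lambda>\<theta>. k \<theta> *\<^sub>R unit_normal c \<theta>) \<theta>)
        * norm (vector_derivative (chart c f) (at \<theta>))
      = (1 - f \<theta> * curvature c \<theta>)\<^sup>2 * h \<theta> * k \<theta>
        / sqrt ((1 - f \<theta> * curvature c \<theta>)\<^sup>2 + (deriv f \<theta>)\<^sup>2)" for \<theta>
  proof -
    define v where "v = vector_derivative c (at \<theta>)"
    define p where "p = 1 - f \<theta> * curvature c \<theta>"
    define q where "q = deriv f \<theta>"
    define w where "w = p *\<^sub>R v + q *\<^sub>R (\<i> * v)"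
    define s where "s = norm w"
    define N where "N = \<i> * sgn w"
    have one: "Re v * Re v + Im v * Im v = 1"
      using assms(2) by (metis arclength_param_def cmod_power2 one_power2 v_def power2_eq_square)
    have w: "vector_derivative (chart c f) (at \<theta>) = w"
      using vector_derivative_at[OF chart_has_vector_derivative[OF assms]]
      by (simp add: unit_normal_arclength[OF assms(2)] v_def p_def q_def w_def)
    have s: "s = sqrt (p\<^sup>2 + q\<^sup>2)"
      using chart_speed[OF assms, of \<theta>] by (simp add: w s_def p_def q_def)
    have N: "unit_normal (chart c f) \<theta> = N"
      by (simp add: unit_normal_def w N_def)
    have "(\<i> * v) \<bullet> (\<i> * w) = p"
      using one by (simp add: inner_complex_def w_def) algebra
    moreover have "N = (1 / s) *\<^sub>R (\<i> * w)"
      by (simp add: N_def sgn_div_norm s_def divide_inverse)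
    ultimately have nN: "(\<i> * v) \<bullet> N = p / s"
      by (simp only: inner_scaleR_right) simp
    have NN: "N \<bullet> N = (if s = 0 then 0 else 1)"
      by (simp add: N_def dot_square_norm norm_mult norm_sgn s_def)
    have "((h \<theta> *\<^sub>R (\<i> * v)) \<bullet> N) *\<^sub>R N \<bullet> (((k \<theta> *\<^sub>R (\<i> * v)) \<bullet> N) *\<^sub>R N) * s
        = p\<^sup>2 * h \<theta> * k \<theta> / s"
      by (simp add: nN NN power2_eq_square)
    then show ?thesis
      by (simp add: normal_part_def N w unit_normal_arclength[OF assms(2)] v_def[symmetric]
          s_def[symmetric] s p_def q_def)
  qed
  then show ?thesis
    by (simp add: metric_chart_def metric_shape_def metric_imm_def curve_length_chart_eq[OF assms])
qed

end

theory Submission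
  imports Defs
begin

text \<open>
  In the chart the metric is \<open>G\<^sub>f(h,k) = \<phi>(L(f)) Q(f)\<close>, where \<open>L(f)\<close> and \<open>Q(f)\<close> integrate the two functions
  \<open>speed p q = \<surd>(p\<^sup>2 + q\<^sup>2)\<close> and \<open>normal_weight p q = p\<^sup>2 / \<surd>(p\<^sup>2 + q\<^sup>2)\<close> of \<open>p = 1 - f\<kappa>\<close>, \<open>q = f'\<close>, the second one
  against \<open>hk\<close>. The curvature formula sees only the Taylor expansion of \<open>G\<close> at \<open>f = 0\<close> to order two, and
  there \<open>p = 1\<close>, \<open>q = 0\<close>: the Hessians of both functions have the single nonzero entry \<open>1\<close>, respectively
  \<open>-1\<close>, in the direction \<open>qq\<close>. Hence
  \<open>L(f) = l - \<langle>f,\<kappa>\<rangle> + \<parallel>f'\<parallel>\<^sup>2/2 + \<dots>\<close> and \<open>Q(f) = \<integral>(1 - f\<kappa> - f'\<^sup>2/2 + \<dots>) hk\<close>.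
  As \<open>p\<close> and \<open>q\<close> are affine in \<open>f\<close>, a single differentiation under the integral sign
  (\<open>shape_integral_DERIV\<close>) yields all derivatives: it is applied to the two functions, and once more to
  their partial derivatives. The results are \<open>first_variation\<close> and \<open>second_variation\<close>.

  At \<open>f = 0\<close> the metric is \<open>\<phi>(l)\<close> times the \<open>L\<^sup>2\<close> product, and every first variation in the equation for
  \<open>\<Gamma>(h,k)\<close> is the \<open>L\<^sup>2\<close> product of \<open>j\<close> with an explicit smooth function. So the equation has a solution that can be
  read off, a combination of \<open>h\<close>, \<open>k\<close>, \<open>\<kappa>hk\<close> and \<open>\<kappa>\<close> (\<open>christoffel_eq\<close>); it is the only one because the \<open>L\<^sup>2\<close>
  product is definite on smooth functions. It lies in the space of smooth functions on the circle because
  the curvature does.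

  Substituting, the integrals of \<open>\<kappa>h\<^sup>2m\<close>, \<open>\<kappa>hm\<^sup>2\<close> and \<open>\<kappa>\<^sup>2h\<^sup>2m\<^sup>2\<close> cancel, and the terms without \<open>\<phi>'\<close> and \<open>\<phi>''\<close>
  form the square \<open>\<parallel>m'h - mh'\<parallel>\<^sup>2\<close>.
\<close>

section \<open>Smooth functions\<close>

lemma smooth_differentiable:
  assumes "smooth_on UNIV u"
  shows "u differentiable (at t)"
proof -
  have "((\<lambda>v t. vector_derivative v (at t)) ^^ 0) u differentiable (at t)"
    using assms unfolding smooth_on_def by blast
  then show ?thesis by simp
qed

lemma smooth_vector_derivative:
  assumes "smooth_on UNIV u"
  shows "smooth_on UNIV (\<lambda>t. vector_derivative u (at t))"
  unfolding smooth_on_def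
proof (intro allI ballI)
  fix n t
  have "((\<lambda>v t. vector_derivative v (at t)) ^^ Suc n) u differentiable (at t)"
    using assms unfolding smooth_on_def by blast
  then show "((\<lambda>v t. vector_derivative v (at t)) ^^ n) (\<lambda>t. vector_derivative u (at t))
      differentiable (at t)"
    by (simp only: funpow_Suc_right o_apply)
qed

text \<open>
  Iterated derivatives of a product are awkward to handle one at a time. It is enough to exhibit a class of
  functions that contains the given one and is closed under differentiation.
\<close>

lemma smooth_on_coinduct:
  assumes "X u"
    and step: "\<And>u. X u \<Longrightarrow> \<exists>u'. X u' \<and> (\<forall>t. (u has_vector_derivative u' t) (at t))"
  shows "smooth_on UNIV u"
proof -
  let ?D = "\<lambda>v t. vector_derivative v (at t)"
  have D: "X (?D v)" and diff: "v differentiable (at t)" if "X v" for v t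
  proof -
    obtain v' where v': "X v'" "\<And>t. (v has_vector_derivative v' t) (at t)"
      using step[OF \<open>X v\<close>] by blast
    then have "?D v = v'" by (auto intro!: ext vector_derivative_at)
    with v' show "X (?D v)" by simp
    show "v differentiable (at t)" using v'(2) by (rule differentiableI_vector)
  qed
  have "X ((?D ^^ n) u)" for n
    by (induction n) (simp_all add: \<open>X u\<close> D)
  then show ?thesis unfolding smooth_on_def using diff by blast
qed

text \<open>
  The closed class for products: by the Leibniz rule the derivative of \<open>B(u,v)\<close> is again a sum of such
  values.
\<close>

inductive bilinear_closure ::
  "('a::real_normed_vector \<Rightarrow> 'b::real_normed_vector \<Rightarrow> 'c::real_normed_vector) \<Rightarrow>
   (real \<Rightarrow> 'c) \<Rightarrow> bool" for B where
  base: "smooth_on UNIV w \<Longrightarrow> bilinear_closure B w"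
| prod: "smooth_on UNIV u \<Longrightarrow> smooth_on UNIV v \<Longrightarrow> bilinear_closure B (\<lambda>t. B (u t) (v t))"
| add: "bilinear_closure B w \<Longrightarrow> bilinear_closure B z \<Longrightarrow> bilinear_closure B (\<lambda>t. w t + z t)"

lemma bilinear_closure_smooth:
  assumes B: "bounded_bilinear B" and "bilinear_closure B w"
  shows "smooth_on UNIV w"
  using assms(2)
proof (rule smooth_on_coinduct)
  fix w assume "bilinear_closure B w"
  then show "\<exists>w'. bilinear_closure B w' \<and> (\<forall>t. (w has_vector_derivative w' t) (at t))"
  proof induction
    case (base w)
    then show ?case
      using smooth_on_derivs(1) smooth_vector_derivative bilinear_closure.base by blast
  next
    case (prod u v)
    let ?u = "\<lambda>t. vector_derivative u (at t)" and ?v = "\<lambda>t. vector_derivative v (at t)"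
    have "bilinear_closure B (\<lambda>t. B (u t) (?v t) + B (?u t) (v t))"
      by (intro bilinear_closure.add bilinear_closure.prod prod smooth_vector_derivative)
    moreover have "((\<lambda>t. B (u t) (v t)) has_vector_derivative B (u t) (?v t) + B (?u t) (v t)) (at t)"
      for t
      by (intro bounded_bilinear.has_vector_derivative[OF B] smooth_on_derivs(1) prod)
    ultimately show ?case by blast
  next
    case (add w z)
    then obtain w' z' where
      "bilinear_closure B w'" "\<And>t. (w has_vector_derivative w' t) (at t)"
      "bilinear_closure B z'" "\<And>t. (z has_vector_derivative z' t) (at t)"
      by blast
    then show ?case
      by (intro exI[of _ "\<lambda>t. w' t + z' t"])
        (auto intro: bilinear_closure.add has_vector_derivative_add)
  qed
qed

lemma smooth_on_bilinear:
  assumes "bounded_bilinear B" "smooth_on UNIV u" "smooth_on UNIV v"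
  shows "smooth_on UNIV (\<lambda>t. B (u t) (v t))"
  using bilinear_closure_smooth[OF assms(1)] bilinear_closure.prod[OF assms(2,3)] .

lemma smooth_on_mult:
  fixes u v :: "real \<Rightarrow> real"
  assumes "smooth_on UNIV u" "smooth_on UNIV v"
  shows "smooth_on UNIV (\<lambda>t. u t * v t)"
  using smooth_on_bilinear[OF bounded_bilinear_mult assms] .

lemma smooth_on_add:
  fixes u v :: "real \<Rightarrow> real"
  assumes "smooth_on UNIV u" "smooth_on UNIV v"
  shows "smooth_on UNIV (\<lambda>t. u t + v t)"
  using bilinear_closure_smooth[OF bounded_bilinear_mult] assms
  by (blast intro: bilinear_closure.intros)

lemma smooth_on_const: "smooth_on UNIV (\<lambda>t. a)"
  by (rule smooth_on_coinduct[where X = "\<lambda>u. \<exists>a. u = (\<lambda>t. a)"])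
    (auto intro!: exI[of _ "\<lambda>t. 0"] has_vector_derivative_const)

lemmas smooth_intros = smooth_on_add smooth_on_mult smooth_on_const

lemma smooth_on_DERIV:
  fixes u :: "real \<Rightarrow> real"
  assumes "smooth_on UNIV u"
  shows "(u has_real_derivative deriv u t) (at t)"
    and "(\<lambda>t. vector_derivative u (at t)) = deriv u"
proof -
  have *: "(u has_real_derivative vector_derivative u (at t)) (at t)" for t
    using smooth_on_derivs(1)[OF assms]
    by (simp add: has_real_derivative_iff_has_vector_derivative)
  show eq: "(\<lambda>t. vector_derivative u (at t)) = deriv u"
    by (rule ext) (rule DERIV_imp_deriv[OF *, symmetric])
  show "(u has_real_derivative deriv u t) (at t)"
    using *[of t] fun_cong[OF eq, of t] by simp
qed

lemma smooth_on_deriv: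
  fixes u :: "real \<Rightarrow> real"
  assumes "smooth_on UNIV u"
  shows "smooth_on UNIV (deriv u)"
  using smooth_vector_derivative[OF assms] smooth_on_DERIV(2)[OF assms] by simp

lemma smooth_on_continuous:
  assumes "smooth_on UNIV u"
  shows "continuous_on S u"
  using smooth_differentiable[OF assms]
  by (meson continuous_at_imp_continuous_on differentiable_imp_continuous_within)

text \<open>
  \<^const>\<open>smooth_on\<close> speaks of \<^const>\<open>vector_derivative\<close>, which agrees with \<^const>\<open>deriv\<close> only where the
  function is differentiable; openness of \<open>S\<close> makes the two agree near \<open>x\<close>, as the second derivative needs.
\<close>

lemma smooth_on_DERIV_twice:
  fixes \<phi> :: "real \<Rightarrow> real"
  assumes "smooth_on S \<phi>" "open S" "x \<in> S"
  shows "(\<phi> has_real_derivative deriv \<phi> x) (at x)"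
    and "(deriv \<phi> has_real_derivative deriv (deriv \<phi>) x) (at x)"
proof -
  let ?D = "\<lambda>v t. vector_derivative v (at t)"
  have diff: "(?D ^^ n) \<phi> differentiable (at t)" if "t \<in> S" for n t
    using assms(1) that by (simp add: smooth_on_def)
  have *: "(\<phi> has_real_derivative ?D \<phi> t) (at t)" if "t \<in> S" for t
    using diff[OF that, of 0]
    by (simp add: has_real_derivative_iff_has_vector_derivative vector_derivative_works)
  then have eq: "?D \<phi> t = deriv \<phi> t" if "t \<in> S" for t
    using DERIV_imp_deriv[OF *[OF that]] by simp
  show "(\<phi> has_real_derivative deriv \<phi> x) (at x)"
    using *[OF assms(3)] eq[OF assms(3)] by simp
  have "(?D \<phi> has_real_derivative ?D (?D \<phi>) x) (at x)"
    using diff[OF assms(3), of 1]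
    by (simp add: has_real_derivative_iff_has_vector_derivative vector_derivative_works)
  then have "(deriv \<phi> has_real_derivative ?D (?D \<phi>) x) (at x)"
    by (rule has_field_derivative_transform_within_open[OF _ assms(2,3)]) (simp add: eq)
  then show "(deriv \<phi> has_real_derivative deriv (deriv \<phi>) x) (at x)"
    by (simp add: DERIV_imp_deriv)
qed

lemma circle_smooth_vector_derivative:
  assumes "u \<in> circle_smooth l"
  shows "(\<lambda>t. vector_derivative u (at t)) \<in> circle_smooth l"
proof -
  have u: "smooth_on UNIV u" and per: "(\<lambda>t. u (t + l)) = u"
    using assms by (auto simp: circle_smooth_def)
  have "vector_derivative u (at (t + l)) = vector_derivative u (at t)" for t
  proof -
    have s: "((\<lambda>t. t + l) has_real_derivative 1) (at t)"
      by (auto intro!: derivative_eq_intros)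
    have "(u \<circ> (\<lambda>t. t + l) has_vector_derivative 1 *\<^sub>R vector_derivative u (at (t + l))) (at t)"
      by (rule vector_diff_chain_at)
        (use s smooth_on_derivs(1)[OF u] in
          \<open>auto simp: has_real_derivative_iff_has_vector_derivative\<close>)
    then show ?thesis
      using per by (simp add: o_def vector_derivative_at)
  qed
  with smooth_vector_derivative[OF u] show ?thesis
    by (simp add: circle_smooth_def)
qed

text \<open>
  As \<open>\<i>c'\<close> is a unit vector, the curvature is the inner product of \<open>c''\<close> with \<open>\<i>c'\<close>, a bilinear expression in
  smooth functions.
\<close>

lemma curvature_circle_smooth:
  assumes "c \<in> circle_smooth l" "arclength_param c"
  shows "curvature c \<in> circle_smooth l"
proof -
  let ?v = "\<lambda>t. vector_derivative c (at t)"
  let ?a = "\<lambda>t. vector_derivative ?v (at t)"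
  have v: "?v \<in> circle_smooth l" and a: "?a \<in> circle_smooth l"
    using assms(1) by (blast intro: circle_smooth_vector_derivative)+
  have c: "smooth_on UNIV c" using assms(1) by (simp add: circle_smooth_def)
  have "curvature c t = ?a t \<bullet> (\<i> * ?v t)" for t
  proof -
    have "(\<i> * ?v t) \<bullet> (\<i> * ?v t) = 1"
      using assms(2) by (simp add: arclength_param_def dot_square_norm norm_mult)
    moreover have "?a t = curvature c t *\<^sub>R (\<i> * ?v t)"
      using curvature_works[OF c assms(2), of t] by (simp add: unit_normal_arclength[OF assms(2)])
    ultimately show ?thesis by simp
  qed
  then have eq: "curvature c = (\<lambda>t. ?a t \<bullet> (\<i> * ?v t))" by (rule ext)
  have B: "bounded_bilinear (\<lambda>(x::complex) y. x \<bullet> (\<i> * y))"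
    by (rule bounded_bilinear.comp[OF bounded_bilinear_inner bounded_linear_ident
          bounded_linear_mult_right])
  have "smooth_on UNIV (\<lambda>t. ?a t \<bullet> (\<i> * ?v t))"
    using smooth_on_bilinear[OF B, of ?a ?v] a v by (simp add: circle_smooth_def)
  moreover have "?a (t + l) \<bullet> (\<i> * ?v (t + l)) = ?a t \<bullet> (\<i> * ?v t)" for t
    using a v unfolding circle_smooth_def by simp
  ultimately show ?thesis
    unfolding eq circle_smooth_def by blast
qed

section \<open>Variation of integrals over the circle\<close>

text \<open>
  The integrands are functions \<open>\<Phi>\<close> of two real variables which are singular at the origin. The variables are
  only evaluated at \<open>p = 1 - f\<kappa> > 0\<close>, so \<open>\<Phi>\<close> has to be \<open>C\<^sup>1\<close> only on the right half plane. The chain rule along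
  curves says that \<open>\<Phi>\<^sub>1\<close> and \<open>\<Phi>\<^sub>2\<close> are its partial derivatives, and in this form it is directly provable by
  and usable in one-variable calculus.
\<close>

definition kernel_partials ::
  "(real \<Rightarrow> real \<Rightarrow> real) \<Rightarrow> (real \<Rightarrow> real \<Rightarrow> real) \<Rightarrow> (real \<Rightarrow> real \<Rightarrow> real) \<Rightarrow> bool" where
  "kernel_partials \<Phi> \<Phi>\<^sub>1 \<Phi>\<^sub>2 \<longleftrightarrow>
     (\<forall>P Q a b s. (P has_real_derivative a) (at s) \<longrightarrow> (Q has_real_derivative b) (at s) \<longrightarrow> 0 < P s \<longrightarrow>
        ((\<lambda>s. \<Phi> (P s) (Q s)) has_real_derivative \<Phi>\<^sub>1 (P s) (Q s) * a + \<Phi>\<^sub>2 (P s) (Q s) * b) (at s)) \<and>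
     continuous_on {z. 0 < fst z} (\<lambda>z. \<Phi> (fst z) (snd z)) \<and>
     continuous_on {z. 0 < fst z} (\<lambda>z. \<Phi>\<^sub>1 (fst z) (snd z)) \<and>
     continuous_on {z. 0 < fst z} (\<lambda>z. \<Phi>\<^sub>2 (fst z) (snd z))"

text \<open>
  By compactness of the interval, \<open>\<delta>\<close> can be taken as the minimum of \<open>p\<close> divided by a bound for \<open>\<bar>a\<bar>\<close>, which is
  increased by 1 to make it positive.
\<close>

lemma eventually_positive_perturbation:
  fixes p a :: "real \<Rightarrow> real"
  assumes "continuous_on {0..l} p" "continuous_on {0..l} a" "\<And>\<theta>. \<theta> \<in> {0..l} \<Longrightarrow> 0 < p \<theta>"
  obtains \<delta> where "0 < \<delta>" "\<And>s \<theta>. \<bar>s\<bar> < \<delta> \<Longrightarrow> \<theta> \<in> {0..l} \<Longrightarrow> 0 < p \<theta> + s * a \<theta>"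
proof (cases "0 \<le> l")
  case False
  then show ?thesis using that[of 1] by simp
next
  case True
  then obtain x where x: "x \<in> {0..l}" "\<And>\<theta>. \<theta> \<in> {0..l} \<Longrightarrow> p x \<le> p \<theta>"
    using continuous_attains_inf[OF compact_Icc _ assms(1)] by auto
  have "continuous_on {0..l} (\<lambda>\<theta>. \<bar>a \<theta>\<bar>)"
    using assms(2) by (intro continuous_intros)
  then have "\<exists>y\<in>{0..l}. \<forall>\<theta>\<in>{0..l}. \<bar>a \<theta>\<bar> \<le> \<bar>a y\<bar>"
    using True by (intro continuous_attains_sup compact_Icc) auto
  then obtain y where y: "\<And>\<theta>. \<theta> \<in> {0..l} \<Longrightarrow> \<bar>a \<theta>\<bar> \<le> \<bar>a y\<bar>"
    by blast
  have px: "0 < p x" using assms(3) x(1) by blast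
  have "0 < p \<theta> + s * a \<theta>" if s: "\<bar>s\<bar> < p x / (1 + \<bar>a y\<bar>)" and \<theta>: "\<theta> \<in> {0..l}" for s \<theta>
  proof -
    have "\<bar>s * a \<theta>\<bar> \<le> \<bar>s\<bar> * (1 + \<bar>a y\<bar>)"
      using y[OF \<theta>] by (simp add: abs_mult mult_left_mono)
    also have "\<dots> < p x" using s by (simp add: pos_less_divide_eq)
    finally show ?thesis using x(2)[OF \<theta>] by linarith
  qed
  then show ?thesis
    using that[of "p x / (1 + \<bar>a y\<bar>)"] px by simp
qed

lemma kernel_compose_continuous:
  fixes P Q :: "'a::topological_space \<Rightarrow> real"
  assumes "continuous_on {z. 0 < fst z} (\<lambda>z. \<Phi> (fst z) (snd z) :: real)"
    "continuous_on S P" "continuous_on S Q" "\<And>x. x \<in> S \<Longrightarrow> 0 < P x"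
  shows "continuous_on S (\<lambda>x. \<Phi> (P x) (Q x))"
proof -
  have "continuous_on S (\<lambda>x. (P x, Q x))"
    using assms(2,3) by (rule continuous_on_Pair)
  from continuous_on_compose2[OF assms(1) this] assms(4) show ?thesis
    by (simp add: image_subset_iff)
qed

text \<open>
  The Leibniz rule on an interval around \<open>0\<close> on which the first argument stays positive. The derivative is
  given as two integrals of the same shape as the given one, so that the lemma can be applied again to each
  of them.
\<close>

lemma integral_kernel_DERIV:
  fixes p q a b g :: "real \<Rightarrow> real"
  assumes part: "kernel_partials \<Phi> \<Phi>\<^sub>1 \<Phi>\<^sub>2"
    and cont: "continuous_on {0..l} p" "continuous_on {0..l} q" "continuous_on {0..l} a"
      "continuous_on {0..l} b" "continuous_on {0..l} g"
    and pos: "\<And>\<theta>. \<theta> \<in> {0..l} \<Longrightarrow> 0 < p \<theta>"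
  shows "((\<lambda>s. integral {0..l} (\<lambda>\<theta>. \<Phi> (p \<theta> + s * a \<theta>) (q \<theta> + s * b \<theta>) * g \<theta>)) has_real_derivative
      integral {0..l} (\<lambda>\<theta>. \<Phi>\<^sub>1 (p \<theta>) (q \<theta>) * (a \<theta> * g \<theta>))
      + integral {0..l} (\<lambda>\<theta>. \<Phi>\<^sub>2 (p \<theta>) (q \<theta>) * (b \<theta> * g \<theta>))) (at 0)"
proof -
  obtain \<delta> where \<delta>: "0 < \<delta>" "\<And>s \<theta>. \<bar>s\<bar> < \<delta> \<Longrightarrow> \<theta> \<in> {0..l} \<Longrightarrow> 0 < p \<theta> + s * a \<theta>"
    using eventually_positive_perturbation[OF cont(1,3)] pos by blast
  let ?U = "{-\<delta><..<\<delta>}"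
  let ?F = "\<lambda>s \<theta>. \<Phi> (p \<theta> + s * a \<theta>) (q \<theta> + s * b \<theta>) * g \<theta>"
  let ?F' = "\<lambda>s \<theta>. (\<Phi>\<^sub>1 (p \<theta> + s * a \<theta>) (q \<theta> + s * b \<theta>) * a \<theta>
      + \<Phi>\<^sub>2 (p \<theta> + s * a \<theta>) (q \<theta> + s * b \<theta>) * b \<theta>) * g \<theta>"
  have c\<Phi>: "continuous_on {z. 0 < fst z} (\<lambda>z. \<Phi> (fst z) (snd z))"
     "continuous_on {z. 0 < fst z} (\<lambda>z. \<Phi>\<^sub>1 (fst z) (snd z))"
     "continuous_on {z. 0 < fst z} (\<lambda>z. \<Phi>\<^sub>2 (fst z) (snd z))"
    using part by (auto simp: kernel_partials_def)
  have line: "((\<lambda>s. x + s * y) has_real_derivative y) (at s)" for x y s :: real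
    by (auto intro!: derivative_eq_intros)
  have DF: "((\<lambda>s. ?F s \<theta>) has_real_derivative ?F' s \<theta>) (at s within ?U)"
    if "s \<in> ?U" "\<theta> \<in> cbox 0 l" for s \<theta>
  proof -
    have "((\<lambda>s. \<Phi> (p \<theta> + s * a \<theta>) (q \<theta> + s * b \<theta>)) has_real_derivative
       \<Phi>\<^sub>1 (p \<theta> + s * a \<theta>) (q \<theta> + s * b \<theta>) * a \<theta> + \<Phi>\<^sub>2 (p \<theta> + s * a \<theta>) (q \<theta> + s * b \<theta>) * b \<theta>) (at s)"
      using part[unfolded kernel_partials_def, THEN conjunct1, rule_format,
          of "\<lambda>s. p \<theta> + s * a \<theta>" "a \<theta>" s "\<lambda>s. q \<theta> + s * b \<theta>" "b \<theta>", OF line line] \<delta>(2)[of s \<theta>]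
        that by auto
    from DERIV_cmult_right[OF this, of "g \<theta>"]
    show ?thesis by (rule has_field_derivative_at_within)
  qed
  have int: "?F s integrable_on cbox 0 l" if "s \<in> ?U" for s
    unfolding cbox_interval using \<delta>(2)[of s] that
    by (intro integrable_continuous_real continuous_intros cont kernel_compose_continuous[OF c\<Phi>(1)])
      auto
  have snd: "continuous_on (?U \<times> {0..l}) (\<lambda>z. u (snd z))" if "continuous_on {0..l} u" for u :: "real \<Rightarrow> real"
    by (rule continuous_on_compose2[OF that]) (auto intro: continuous_intros)
  have "continuous_on (?U \<times> {0..l}) (\<lambda>z. ?F' (fst z) (snd z))"
    using \<delta>(2)
    by (intro continuous_intros cont[THEN snd] kernel_compose_continuous[OF c\<Phi>(2)]
        kernel_compose_continuous[OF c\<Phi>(3)]) auto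
  then have cF': "continuous_on (?U \<times> cbox 0 l) (\<lambda>(s, \<theta>). ?F' s \<theta>)"
    by (simp add: case_prod_beta)
  have "((\<lambda>s. integral (cbox 0 l) (?F s)) has_real_derivative integral (cbox 0 l) (?F' 0)) (at 0 within ?U)"
    by (rule leibniz_rule_field_derivative[OF DF int cF']) (use \<delta>(1) in auto)
  then have D: "((\<lambda>s. integral {0..l} (?F s)) has_real_derivative integral {0..l} (?F' 0)) (at 0)"
    using at_within_open[of 0 ?U] \<delta>(1) by simp
  have "integral {0..l} (?F' 0) = integral {0..l} (\<lambda>\<theta>. \<Phi>\<^sub>1 (p \<theta>) (q \<theta>) * (a \<theta> * g \<theta>) + \<Phi>\<^sub>2 (p \<theta>) (q \<theta>) * (b \<theta> * g \<theta>))"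
    by (simp add: algebra_simps)
  also have "\<dots> = integral {0..l} (\<lambda>\<theta>. \<Phi>\<^sub>1 (p \<theta>) (q \<theta>) * (a \<theta> * g \<theta>))
      + integral {0..l} (\<lambda>\<theta>. \<Phi>\<^sub>2 (p \<theta>) (q \<theta>) * (b \<theta> * g \<theta>))"
    by (intro integral_add integrable_continuous_real continuous_intros cont pos
        kernel_compose_continuous[OF c\<Phi>(2)] kernel_compose_continuous[OF c\<Phi>(3)])
  finally show ?thesis using D by simp
qed

text \<open>
  The integral of \<open>\<Phi>\<close> at the curve with coordinate \<open>f\<close>, since \<open>(1 - f\<kappa>) c' + f' n\<^sub>c\<close> is the velocity of \<open>c + f n\<^sub>c\<close>.
\<close>

definition shape_integral ::
  "real \<Rightarrow> (real \<Rightarrow> real) \<Rightarrow> (real \<Rightarrow> real \<Rightarrow> real) \<Rightarrow> (real \<Rightarrow> real) \<Rightarrow> (real \<Rightarrow> real) \<Rightarrow> real" where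
  "shape_integral l \<kappa> \<Phi> f g = integral {0..l} (\<lambda>\<theta>. \<Phi> (1 - f \<theta> * \<kappa> \<theta>) (deriv f \<theta>) * g \<theta>)"

lemma deriv_line:
  fixes f j :: "real \<Rightarrow> real"
  assumes "smooth_on UNIV f" "smooth_on UNIV j"
  shows "deriv (\<lambda>\<theta>. f \<theta> + s * j \<theta>) = (\<lambda>\<theta>. deriv f \<theta> + s * deriv j \<theta>)"
  by (intro ext DERIV_imp_deriv)
    (auto intro!: derivative_eq_intros smooth_on_DERIV(1)[OF assms(1)] smooth_on_DERIV(1)[OF assms(2)])

lemma shape_integral_DERIV:
  assumes part: "kernel_partials \<Phi> \<Phi>\<^sub>1 \<Phi>\<^sub>2"
    and f: "smooth_on UNIV f" and j: "smooth_on UNIV j"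
    and \<kappa>: "continuous_on {0..l} \<kappa>" and g: "continuous_on {0..l} g"
    and pos: "\<And>\<theta>. \<theta> \<in> {0..l} \<Longrightarrow> f \<theta> * \<kappa> \<theta> < 1"
  shows "((\<lambda>s. shape_integral l \<kappa> \<Phi> (\<lambda>\<theta>. f \<theta> + s * j \<theta>) g) has_real_derivative
      shape_integral l \<kappa> \<Phi>\<^sub>1 f (\<lambda>\<theta>. - j \<theta> * \<kappa> \<theta> * g \<theta>)
      + shape_integral l \<kappa> \<Phi>\<^sub>2 f (\<lambda>\<theta>. deriv j \<theta> * g \<theta>)) (at 0)"
proof -
  have "((\<lambda>s. integral {0..l} (\<lambda>\<theta>. \<Phi> ((1 - f \<theta> * \<kappa> \<theta>) + s * (- j \<theta> * \<kappa> \<theta>)) (deriv f \<theta> + s * deriv j \<theta>) * g \<theta>))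
    has_real_derivative
      integral {0..l} (\<lambda>\<theta>. \<Phi>\<^sub>1 (1 - f \<theta> * \<kappa> \<theta>) (deriv f \<theta>) * ((- j \<theta> * \<kappa> \<theta>) * g \<theta>))
      + integral {0..l} (\<lambda>\<theta>. \<Phi>\<^sub>2 (1 - f \<theta> * \<kappa> \<theta>) (deriv f \<theta>) * (deriv j \<theta> * g \<theta>))) (at 0)"
    by (rule integral_kernel_DERIV[OF part])
      (use pos in \<open>auto intro!: continuous_intros \<kappa> g smooth_on_continuous[OF f]
        smooth_on_continuous[OF j] smooth_on_continuous[OF smooth_on_deriv[OF f]]
        smooth_on_continuous[OF smooth_on_deriv[OF j]]\<close>)
  then show ?thesis
    by (simp add: shape_integral_def deriv_line[OF f j] algebra_simps)
qed

lemma shape_integral_zero: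
  "shape_integral l \<kappa> \<Phi> (\<lambda>\<theta>. 0) g = \<Phi> 1 0 * integral {0..l} g"
  by (simp add: shape_integral_def)

section \<open>Speed and normal weight\<close>

text \<open>
  All derivatives are polynomials in \<open>p\<close>, \<open>q\<close> and the reciprocal \<open>r\<close> of the speed, because \<open>r\<close> has the
  partial derivatives \<open>-p r\<^sup>3\<close> and \<open>-q r\<^sup>3\<close>. Checking them then takes only polynomial identities in which
  \<open>p\<close>, \<open>q\<close> and \<open>r\<close> are independent. The indices 1 and 2 stand for the partial derivatives by \<open>p\<close> and \<open>q\<close>.
\<close>

definition speed where "speed p q = sqrt (p\<^sup>2 + q\<^sup>2 :: real)"
definition inv_speed where "inv_speed p q = 1 / speed p q"
definition speed\<^sub>1 where "speed\<^sub>1 p q = p * inv_speed p q"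
definition speed\<^sub>2 where "speed\<^sub>2 p q = q * inv_speed p q"
definition normal_weight where "normal_weight p q = p\<^sup>2 * inv_speed p q"
definition normal_weight\<^sub>1 where "normal_weight\<^sub>1 p q = 2 * p * inv_speed p q - p ^ 3 * inv_speed p q ^ 3"
definition normal_weight\<^sub>2 where "normal_weight\<^sub>2 p q = - p\<^sup>2 * q * inv_speed p q ^ 3"

lemma speed_nonzero: "0 < p \<Longrightarrow> speed p q \<noteq> 0"
  by (simp add: speed_def sum_power2_eq_zero_iff)

lemma speed_DERIV:
  assumes "(P has_real_derivative a) (at s)" "(Q has_real_derivative b) (at s)" "0 < P s"
  shows "((\<lambda>s. speed (P s) (Q s)) has_real_derivative
    speed\<^sub>1 (P s) (Q s) * a + speed\<^sub>2 (P s) (Q s) * b) (at s)"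
proof -
  have eq: "inverse w / 2 * (2 * (x * a + y * b)) = x * (1 / w) * a + y * (1 / w) * b"
    for w x y :: real
    by (cases "w = 0") (auto simp: field_simps)
  have pos: "0 < (P s)\<^sup>2 + (Q s)\<^sup>2" using assms(3) by (simp add: sum_power2_gt_zero_iff)
  have "((\<lambda>s. (P s)\<^sup>2 + (Q s)\<^sup>2) has_real_derivative 2 * (P s * a + Q s * b)) (at s)"
    using assms(1,2) by (auto intro!: derivative_eq_intros)
  note D = DERIV_chain2[OF DERIV_real_sqrt[OF pos] this]
  show ?thesis
    unfolding speed_def by (rule DERIV_cong[OF D]) (simp only: speed_def speed\<^sub>1_def speed\<^sub>2_def inv_speed_def eq)
qed

lemma inv_speed_DERIV:
  assumes "(P has_real_derivative a) (at s)" "(Q has_real_derivative b) (at s)" "0 < P s"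
  shows "((\<lambda>s. inv_speed (P s) (Q s)) has_real_derivative
    - (P s * a + Q s * b) * inv_speed (P s) (Q s) ^ 3) (at s)"
  unfolding inv_speed_def using speed_nonzero[OF assms(3)]
  by (auto intro!: derivative_eq_intros speed_DERIV assms
      simp: speed\<^sub>1_def speed\<^sub>2_def inv_speed_def field_simps power3_eq_cube)

lemma speed_continuous: "continuous_on S (\<lambda>z. speed (fst z) (snd z))"
  unfolding speed_def by (intro continuous_intros)

lemma inv_speed_continuous: "continuous_on {z. 0 < fst z} (\<lambda>z. inv_speed (fst z) (snd z))"
  unfolding inv_speed_def by (auto intro!: continuous_intros speed_continuous speed_nonzero)

lemma kernel_partialsI:
  assumes "\<And>P Q a b s. (P has_real_derivative a) (at s) \<Longrightarrow> (Q has_real_derivative b) (at s) \<Longrightarrow>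
      0 < P s \<Longrightarrow>
      ((\<lambda>s. \<Phi> (P s) (Q s)) has_real_derivative \<Phi>\<^sub>1 (P s) (Q s) * a + \<Phi>\<^sub>2 (P s) (Q s) * b) (at s)"
    and "continuous_on {z. 0 < fst z} (\<lambda>z. \<Phi> (fst z) (snd z))"
    and "continuous_on {z. 0 < fst z} (\<lambda>z. \<Phi>\<^sub>1 (fst z) (snd z))"
    and "continuous_on {z. 0 < fst z} (\<lambda>z. \<Phi>\<^sub>2 (fst z) (snd z))"
  shows "kernel_partials \<Phi> \<Phi>\<^sub>1 \<Phi>\<^sub>2"
  using assms unfolding kernel_partials_def by blast

lemma speed_partials: "kernel_partials speed speed\<^sub>1 speed\<^sub>2"
  unfolding speed\<^sub>1_def speed\<^sub>2_def
  by (rule kernel_partialsI)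
    (auto intro!: speed_DERIV[unfolded speed\<^sub>1_def speed\<^sub>2_def] continuous_intros speed_continuous inv_speed_continuous)

lemma speed\<^sub>1_partials: "kernel_partials speed\<^sub>1
    (\<lambda>p q. inv_speed p q - p\<^sup>2 * inv_speed p q ^ 3) (\<lambda>p q. - p * q * inv_speed p q ^ 3)"
  unfolding speed\<^sub>1_def
  by (rule kernel_partialsI)
    (auto intro!: derivative_eq_intros inv_speed_DERIV continuous_intros inv_speed_continuous
      simp: algebra_simps power2_eq_square)

lemma speed\<^sub>2_partials: "kernel_partials speed\<^sub>2
    (\<lambda>p q. - p * q * inv_speed p q ^ 3) (\<lambda>p q. inv_speed p q - q\<^sup>2 * inv_speed p q ^ 3)"
  unfolding speed\<^sub>2_def
  by (rule kernel_partialsI)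
    (auto intro!: derivative_eq_intros inv_speed_DERIV continuous_intros inv_speed_continuous
      simp: algebra_simps power2_eq_square)

lemma normal_weight_partials: "kernel_partials normal_weight normal_weight\<^sub>1 normal_weight\<^sub>2"
  unfolding normal_weight_def normal_weight\<^sub>1_def normal_weight\<^sub>2_def
  by (rule kernel_partialsI)
    (auto intro!: derivative_eq_intros inv_speed_DERIV continuous_intros inv_speed_continuous
      simp: algebra_simps power2_eq_square power3_eq_cube)

lemma normal_weight\<^sub>1_partials: "kernel_partials normal_weight\<^sub>1
    (\<lambda>p q. 2 * inv_speed p q - 5 * p\<^sup>2 * inv_speed p q ^ 3 + 3 * p ^ 4 * inv_speed p q ^ 5)
    (\<lambda>p q. - 2 * p * q * inv_speed p q ^ 3 + 3 * p ^ 3 * q * inv_speed p q ^ 5)"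
  unfolding normal_weight\<^sub>1_def
  by (rule kernel_partialsI)
    (auto intro!: derivative_eq_intros inv_speed_DERIV continuous_intros inv_speed_continuous
      simp: algebra_simps eval_nat_numeral)

lemma normal_weight\<^sub>2_partials: "kernel_partials normal_weight\<^sub>2
    (\<lambda>p q. - 2 * p * q * inv_speed p q ^ 3 + 3 * p ^ 3 * q * inv_speed p q ^ 5)
    (\<lambda>p q. - p\<^sup>2 * inv_speed p q ^ 3 + 3 * p\<^sup>2 * q\<^sup>2 * inv_speed p q ^ 5)"
  unfolding normal_weight\<^sub>2_def
  by (rule kernel_partialsI)
    (auto intro!: derivative_eq_intros inv_speed_DERIV continuous_intros inv_speed_continuous
      simp: algebra_simps eval_nat_numeral)


section \<open>The inner product on the circle\<close>

lemma circle_inner_commute: "circle_inner l u v = circle_inner l v u"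
  by (simp add: circle_inner_def mult.commute)

lemma circle_inner_add_left:
  assumes "continuous_on {0..l} u" "continuous_on {0..l} v" "continuous_on {0..l} w"
  shows "circle_inner l (\<lambda>\<theta>. u \<theta> + v \<theta>) w = circle_inner l u w + circle_inner l v w"
proof -
  have "integral {0..l} (\<lambda>\<theta>. u \<theta> * w \<theta> + v \<theta> * w \<theta>) = circle_inner l u w + circle_inner l v w"
    unfolding circle_inner_def
    by (intro integral_add integrable_continuous_real continuous_intros assms)
  then show ?thesis by (simp add: circle_inner_def distrib_right)
qed

lemma circle_inner_scale_left: "circle_inner l (\<lambda>\<theta>. a * u \<theta>) w = a * circle_inner l u w"
  by (simp add: circle_inner_def mult.assoc)

lemma circle_inner_combination_left:
  assumes "continuous_on {0..l} u" "continuous_on {0..l} v" "continuous_on {0..l} w"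
    "continuous_on {0..l} x" "continuous_on {0..l} y"
  shows "circle_inner l (\<lambda>\<theta>. a * u \<theta> + b * v \<theta> + r * w \<theta> + s * x \<theta>) y =
    a * circle_inner l u y + b * circle_inner l v y + r * circle_inner l w y + s * circle_inner l x y"
  by (simp add: circle_inner_add_left circle_inner_scale_left assms continuous_intros)

lemma circle_norm_square:
  assumes "continuous_on {0..l} u"
  shows "(circle_norm l u)\<^sup>2 = circle_inner l u u"
proof -
  have "0 \<le> circle_inner l u u"
    unfolding circle_inner_def
    by (intro integral_nonneg integrable_continuous_real continuous_intros assms) simp
  then show ?thesis by (simp add: circle_norm_def)
qed

lemma circle_smoothD:
  assumes "u \<in> circle_smooth l"
  shows "smooth_on UNIV u" "continuous_on S u"
  using assms smooth_on_continuous by (auto simp: circle_smooth_def)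

lemma circle_smooth_add:
  fixes u v :: "real \<Rightarrow> real"
  shows "u \<in> circle_smooth l \<Longrightarrow> v \<in> circle_smooth l \<Longrightarrow> (\<lambda>\<theta>. u \<theta> + v \<theta>) \<in> circle_smooth l"
  by (simp add: circle_smooth_def smooth_on_add)

lemma circle_smooth_mult:
  fixes u v :: "real \<Rightarrow> real"
  shows "u \<in> circle_smooth l \<Longrightarrow> v \<in> circle_smooth l \<Longrightarrow> (\<lambda>\<theta>. u \<theta> * v \<theta>) \<in> circle_smooth l"
  by (simp add: circle_smooth_def smooth_on_mult)

lemma circle_smooth_const: "(\<lambda>\<theta>. a) \<in> circle_smooth l"
  by (simp add: circle_smooth_def smooth_on_const)

lemmas circle_smooth_intros = circle_smooth_add circle_smooth_mult circle_smooth_const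

text \<open>
  Test the difference against itself: its square has integral zero, so it vanishes on one period and hence
  everywhere.
\<close>

lemma circle_inner_eqI:
  assumes l: "0 < l" and g: "g \<in> circle_smooth l" and g': "g' \<in> circle_smooth l"
    and eq: "\<And>j. j \<in> circle_smooth l \<Longrightarrow> circle_inner l g j = circle_inner l g' j"
  shows "g = g'"
proof -
  define d where "d = (\<lambda>\<theta>. g \<theta> + (-1) * g' \<theta>)"
  have d: "d \<in> circle_smooth l"
    unfolding d_def by (intro circle_smooth_intros g g')
  have "circle_inner l d d = circle_inner l g d + circle_inner l (\<lambda>\<theta>. (-1) * g' \<theta>) d"
    by (subst d_def, rule circle_inner_add_left)
      (intro continuous_intros circle_smoothD(2)[OF d] circle_smoothD(2)[OF g]
        circle_smoothD(2)[OF g'])+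
  also have "\<dots> = 0"
    using eq[OF d] circle_inner_scale_left[of l "-1" g' d] by simp
  finally have "integral (cbox 0 l) (\<lambda>\<theta>. d \<theta> * d \<theta>) = 0"
    by (simp add: circle_inner_def)
  moreover have "continuous_on (cbox 0 l) (\<lambda>\<theta>. d \<theta> * d \<theta>)"
    by (intro continuous_intros circle_smoothD(2)[OF d])
  ultimately have zero: "\<forall>\<theta>\<in>cbox 0 l. d \<theta> * d \<theta> = 0"
    using l by (subst (asm) integral_cbox_eq_0_iff) auto
  interpret periodic_fun_simple d l
    by unfold_locales (use d in \<open>simp add: circle_smooth_def\<close>)
  have "d t = 0" for t
  proof -
    have "frac (t / l) * l \<in> {0..l}"
      using l frac_lt_1[of "t / l"] by (simp add: mult_le_cancel_right1 less_imp_le)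
    then have "d (frac (t / l) * l) = 0" using zero by simp
    moreover have "frac (t / l) * l = t - of_int \<lfloor>t / l\<rfloor> * l"
      using l by (simp add: frac_def field_simps)
    ultimately show ?thesis using minus_of_int[of t "\<lfloor>t / l\<rfloor>"] by simp
  qed
  then show ?thesis by (simp add: d_def fun_eq_iff)
qed

section \<open>Variations of the metric\<close>

locale arclength_curve =
  fixes \<phi> :: "real \<Rightarrow> real" and l :: real and c :: "real \<Rightarrow> complex"
  assumes \<phi>_smooth: "smooth_on {0<..} \<phi>" and \<phi>_pos: "x > 0 \<Longrightarrow> \<phi> x > 0"
    and l_pos: "0 < l" and c_smooth: "c \<in> circle_smooth l" and arclength: "arclength_param c"
begin

abbreviation \<kappa> where "\<kappa> \<equiv> curvature c"
abbreviation ip where "ip \<equiv> circle_inner l"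
abbreviation G where "G \<equiv> metric_chart \<phi> l c"
abbreviation J where "J \<equiv> shape_integral l \<kappa>"
abbreviation o0 :: "real \<Rightarrow> real" where "o0 \<equiv> (\<lambda>\<theta>. 0)"

lemma \<kappa>_circle_smooth: "\<kappa> \<in> circle_smooth l"
  using c_smooth arclength by (rule curvature_circle_smooth)

lemmas \<kappa>_continuous = circle_smoothD(2)[OF \<kappa>_circle_smooth]

lemma metric_chart_kernels:
  assumes "smooth_on UNIV f"
  shows "G f h k = \<phi> (J speed f (\<lambda>\<theta>. 1)) * J normal_weight f (\<lambda>\<theta>. h \<theta> * k \<theta>)"
  using metric_chart_eq[OF circle_smoothD(1)[OF c_smooth] arclength assms]
  by (simp add: shape_integral_def normal_weight_def inv_speed_def speed_def mult.assoc)

lemma metric_chart_center: "G o0 h k = \<phi> l * ip h k"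
  using l_pos by (simp add: metric_chart_kernels smooth_on_const shape_integral_zero
      speed_def normal_weight_def inv_speed_def circle_inner_def)

text \<open>
  The derivative of \<open>G\<^sub>f(h,k)\<close> in the direction \<open>j\<close> at general \<open>f\<close>, in terms of shape integrals: the second
  variation differentiates this expression once more in \<open>f\<close>.
\<close>

definition dG where
  "dG j h k f = deriv \<phi> (J speed f (\<lambda>\<theta>. 1))
      * (J speed\<^sub>1 f (\<lambda>\<theta>. - j \<theta> * \<kappa> \<theta> * 1) + J speed\<^sub>2 f (\<lambda>\<theta>. deriv j \<theta> * 1)) * J normal_weight f (\<lambda>\<theta>. h \<theta> * k \<theta>)
    + \<phi> (J speed f (\<lambda>\<theta>. 1))
      * (J normal_weight\<^sub>1 f (\<lambda>\<theta>. - j \<theta> * \<kappa> \<theta> * (h \<theta> * k \<theta>)) + J normal_weight\<^sub>2 f (\<lambda>\<theta>. deriv j \<theta> * (h \<theta> * k \<theta>)))"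

lemma dir_deriv_metric:
  assumes f: "smooth_on UNIV f" and j: "smooth_on UNIV j"
    and h: "smooth_on UNIV h" and k: "smooth_on UNIV k"
    and pos: "\<And>\<theta>. \<theta> \<in> {0..l} \<Longrightarrow> f \<theta> * \<kappa> \<theta> < 1" and len: "0 < J speed f (\<lambda>\<theta>. 1)"
  shows "dir_deriv j (\<lambda>f. G f h k) f = dG j h k f"
proof -
  have hk: "continuous_on {0..l} (\<lambda>\<theta>. h \<theta> * k \<theta>)"
    by (intro continuous_intros smooth_on_continuous h k)
  note D = shape_integral_DERIV[OF _ f j \<kappa>_continuous _ pos]
  note DL = D[OF speed_partials continuous_on_const[of _ 1]] and DQ = D[OF normal_weight_partials hk]
  have D\<phi>: "(\<phi> has_real_derivative deriv \<phi> (J speed f (\<lambda>\<theta>. 1))) (at (J speed (\<lambda>\<theta>. f \<theta> + 0 * j \<theta>) (\<lambda>\<theta>. 1)))"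
    using smooth_on_DERIV_twice(1)[OF \<phi>_smooth open_greaterThan] len by simp
  have "G (\<lambda>\<theta>. f \<theta> + s * j \<theta>) h k = \<phi> (J speed (\<lambda>\<theta>. f \<theta> + s * j \<theta>) (\<lambda>\<theta>. 1))
      * J normal_weight (\<lambda>\<theta>. f \<theta> + s * j \<theta>) (\<lambda>\<theta>. h \<theta> * k \<theta>)" for s
    by (intro metric_chart_kernels smooth_intros f j)
  then show ?thesis
    unfolding dir_deriv_def dG_def
    by (intro DERIV_imp_deriv) (auto intro!: derivative_eq_intros DERIV_chain2[OF D\<phi> DL] DQ)
qed

lemma dG_center: "dG j h k o0 = - (deriv \<phi> l * ip j \<kappa> * ip h k)
    - \<phi> l * ip (\<lambda>\<theta>. j \<theta> * \<kappa> \<theta>) (\<lambda>\<theta>. h \<theta> * k \<theta>)"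
  using l_pos by (simp add: dG_def shape_integral_zero speed_def speed\<^sub>1_def speed\<^sub>2_def
      normal_weight_def normal_weight\<^sub>1_def normal_weight\<^sub>2_def inv_speed_def circle_inner_def)

lemma first_variation:
  assumes "smooth_on UNIV j" "smooth_on UNIV h" "smooth_on UNIV k"
  shows "dir_deriv j (\<lambda>f. G f h k) o0 = - (deriv \<phi> l * ip j \<kappa> * ip h k)
    - \<phi> l * ip (\<lambda>\<theta>. j \<theta> * \<kappa> \<theta>) (\<lambda>\<theta>. h \<theta> * k \<theta>)"
  using l_pos dir_deriv_metric[OF smooth_on_const assms, of 0]
  by (simp add: dG_center shape_integral_zero speed_def)

text \<open>
  For \<open>f = t i\<close> with small \<open>t\<close> the inner derivative is \<open>dG\<close>, because the curve is still immersed and of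
  positive length; so \<open>dG\<close> can be differentiated instead. At \<open>p = 1\<close>, \<open>q = 0\<close> the second partial derivatives of
  the speed and of the normal weight vanish except for the one in \<open>qq\<close>, which contributes the terms in
  \<open>i'j'\<close>.
\<close>

lemma second_variation:
  assumes i: "smooth_on UNIV i" and j: "smooth_on UNIV j"
    and h: "smooth_on UNIV h" and k: "smooth_on UNIV k"
  shows "dir_deriv i (dir_deriv j (\<lambda>f. G f h k)) o0 =
      (deriv \<phi> l * ip (deriv i) (deriv j) + deriv (deriv \<phi>) l * ip i \<kappa> * ip j \<kappa>) * ip h k
    + deriv \<phi> l * (ip i \<kappa> * ip (\<lambda>\<theta>. j \<theta> * \<kappa> \<theta>) (\<lambda>\<theta>. h \<theta> * k \<theta>)
                   + ip j \<kappa> * ip (\<lambda>\<theta>. i \<theta> * \<kappa> \<theta>) (\<lambda>\<theta>. h \<theta> * k \<theta>))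
    - \<phi> l * ip (\<lambda>\<theta>. deriv i \<theta> * deriv j \<theta>) (\<lambda>\<theta>. h \<theta> * k \<theta>)" (is "_ = ?R")
proof -
  let ?f = "\<lambda>t \<theta>. 0 + t * i \<theta>"
  have f: "smooth_on UNIV (?f t)" for t
    by (intro smooth_intros i)
  note cont = continuous_intros \<kappa>_continuous smooth_on_continuous[OF h] smooth_on_continuous[OF k]
    smooth_on_continuous[OF j] smooth_on_continuous[OF smooth_on_deriv[OF j]]
  have D: "((\<lambda>t. J \<Phi> (?f t) g) has_real_derivative
      J \<Phi>\<^sub>1 o0 (\<lambda>\<theta>. - i \<theta> * \<kappa> \<theta> * g \<theta>) + J \<Phi>\<^sub>2 o0 (\<lambda>\<theta>. deriv i \<theta> * g \<theta>)) (at 0)"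
    if "kernel_partials \<Phi> \<Phi>\<^sub>1 \<Phi>\<^sub>2" "continuous_on {0..l} g" for \<Phi> \<Phi>\<^sub>1 \<Phi>\<^sub>2 g
    using shape_integral_DERIV[OF that(1) smooth_on_const i \<kappa>_continuous that(2), of 0] by simp
  have L0: "J speed (?f 0) (\<lambda>\<theta>. 1) = l"
    using l_pos by (simp add: shape_integral_zero speed_def)
  have L: "((\<lambda>t. J speed (?f t) (\<lambda>\<theta>. 1)) has_real_derivative - ip i \<kappa>) (at 0)"
    using D[OF speed_partials continuous_on_const[of _ 1]]
    by (simp add: shape_integral_zero speed_def speed\<^sub>1_def speed\<^sub>2_def inv_speed_def circle_inner_def)
  have D\<phi>: "(\<phi> has_real_derivative deriv \<phi> l) (at (J speed (?f 0) (\<lambda>\<theta>. 1)))"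
      "(deriv \<phi> has_real_derivative deriv (deriv \<phi>) l) (at (J speed (?f 0) (\<lambda>\<theta>. 1)))"
    unfolding L0 using smooth_on_DERIV_twice[OF \<phi>_smooth open_greaterThan] l_pos by auto
  have DG: "((\<lambda>t. dG j h k (?f t)) has_real_derivative ?R) (at 0)"
    unfolding dG_def
    by (rule derivative_eq_intros DERIV_chain2[OF D\<phi>(1) L] DERIV_chain2[OF D\<phi>(2) L]
      D[OF speed\<^sub>1_partials] D[OF speed\<^sub>2_partials] D[OF normal_weight_partials] D[OF normal_weight\<^sub>1_partials]
      D[OF normal_weight\<^sub>2_partials] cont refl)+
      (use l_pos in \<open>simp add: shape_integral_zero speed_def speed\<^sub>1_def speed\<^sub>2_def
      normal_weight_def normal_weight\<^sub>1_def normal_weight\<^sub>2_def inv_speed_def circle_inner_def algebra_simps\<close>)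
  have "\<forall>\<^sub>F t in nhds 0. dir_deriv j (\<lambda>f. G f h k) (?f t) = dG j h k (?f t)"
  proof -
    have ci: "continuous_on {0..l} (\<lambda>\<theta>. - (i \<theta> * \<kappa> \<theta>))"
      by (intro continuous_intros smooth_on_continuous[OF i] \<kappa>_continuous)
    obtain \<delta> where \<delta>: "0 < \<delta>" "\<And>t \<theta>. \<bar>t\<bar> < \<delta> \<Longrightarrow> \<theta> \<in> {0..l} \<Longrightarrow> 0 < 1 + t * - (i \<theta> * \<kappa> \<theta>)"
      using eventually_positive_perturbation[OF continuous_on_const[of _ 1] ci] by auto
    have "\<forall>\<^sub>F t in nhds 0. \<bar>t\<bar> < \<delta>"
      using \<delta>(1) by (auto simp: eventually_nhds_metric)
    moreover have "((\<lambda>t. J speed (?f t) (\<lambda>\<theta>. 1)) \<longlongrightarrow> J speed (?f 0) (\<lambda>\<theta>. 1)) (nhds 0)"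
      using DERIV_isCont[OF L] tendsto_at_iff_tendsto_nhds[of "\<lambda>t. J speed (?f t) (\<lambda>\<theta>. 1)" 0]
      unfolding isCont_def by blast
    then have "\<forall>\<^sub>F t in nhds 0. 0 < J speed (?f t) (\<lambda>\<theta>. 1)"
      by (rule order_tendstoD(1)) (simp only: L0 l_pos)
    ultimately show ?thesis
    proof eventually_elim
      case (elim t)
      have "?f t \<theta> * \<kappa> \<theta> < 1" if "\<theta> \<in> {0..l}" for \<theta>
        using \<delta>(2)[OF elim(1) that] by (simp add: mult.assoc)
      then show ?case
        by (intro dir_deriv_metric f j h k elim(2))
    qed
  qed
  from DERIV_cong_ev[OF refl this refl] DG
  have "((\<lambda>t. dir_deriv j (\<lambda>f. G f h k) (?f t)) has_real_derivative ?R) (at 0)"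
    by (rule iffD2)
  then show ?thesis
    unfolding dir_deriv_def[of i] by (rule DERIV_imp_deriv)
qed

text \<open>
  By the first variation both sides of the defining equation are \<open>L\<^sup>2\<close> products with \<open>j\<close>. The terms in
  \<open>\<kappa>hkj\<close> are the same for the three derivatives, so one of them survives with the opposite sign.
\<close>

lemma christoffel_eq:
  assumes h: "h \<in> circle_smooth l" and k: "k \<in> circle_smooth l"
  shows "christoffel \<phi> l c o0 h k = (\<lambda>\<theta>.
      deriv \<phi> l * ip k \<kappa> / (2 * \<phi> l) * h \<theta> + deriv \<phi> l * ip h \<kappa> / (2 * \<phi> l) * k \<theta>
      + 1/2 * (\<kappa> \<theta> * (h \<theta> * k \<theta>)) + (- deriv \<phi> l * ip h k / (2 * \<phi> l)) * \<kappa> \<theta>)" (is "_ = ?\<Gamma>")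
proof -
  let ?R = "\<lambda>j. dir_deriv j (\<lambda>f. G f h k) o0 - dir_deriv h (\<lambda>f. G f k j) o0
             - dir_deriv k (\<lambda>f. G f h j) o0"
  have \<Gamma>: "?\<Gamma> \<in> circle_smooth l"
    by (intro circle_smooth_intros h k \<kappa>_circle_smooth)
  have \<phi>l: "\<phi> l > 0" using \<phi>_pos l_pos by simp
  have \<Gamma>j: "2 * G o0 ?\<Gamma> j = ?R j" if j: "j \<in> circle_smooth l" for j
  proof -
    note sm = circle_smoothD[OF h] circle_smoothD[OF k] circle_smoothD[OF j] \<kappa>_continuous
    have 1: "ip (\<lambda>\<theta>. j \<theta> * \<kappa> \<theta>) (\<lambda>\<theta>. h \<theta> * k \<theta>) = ip (\<lambda>\<theta>. \<kappa> \<theta> * (h \<theta> * k \<theta>)) j"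
      "ip (\<lambda>\<theta>. h \<theta> * \<kappa> \<theta>) (\<lambda>\<theta>. k \<theta> * j \<theta>) = ip (\<lambda>\<theta>. \<kappa> \<theta> * (h \<theta> * k \<theta>)) j"
      "ip (\<lambda>\<theta>. k \<theta> * \<kappa> \<theta>) (\<lambda>\<theta>. h \<theta> * j \<theta>) = ip (\<lambda>\<theta>. \<kappa> \<theta> * (h \<theta> * k \<theta>)) j"
      by (simp_all add: circle_inner_def mult_ac)
    have "ip ?\<Gamma> j = deriv \<phi> l * ip k \<kappa> / (2 * \<phi> l) * ip h j + deriv \<phi> l * ip h \<kappa> / (2 * \<phi> l) * ip k j
      + 1/2 * ip (\<lambda>\<theta>. \<kappa> \<theta> * (h \<theta> * k \<theta>)) j + (- deriv \<phi> l * ip h k / (2 * \<phi> l)) * ip \<kappa> j"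
      by (intro circle_inner_combination_left continuous_intros sm)
    then show ?thesis
      using \<phi>l by (simp add: metric_chart_center first_variation sm 1 circle_inner_commute[of l j \<kappa>])
        (simp add: field_simps)
  qed
  show ?thesis
    unfolding christoffel_def
  proof (rule the_equality)
    show "?\<Gamma> \<in> circle_smooth l \<and> (\<forall>j\<in>circle_smooth l. 2 * G o0 ?\<Gamma> j = ?R j)"
      using \<Gamma> \<Gamma>j by blast
  next
    fix g assume g: "g \<in> circle_smooth l \<and> (\<forall>j\<in>circle_smooth l. 2 * G o0 g j = ?R j)"
    show "g = ?\<Gamma>"
    proof (rule circle_inner_eqI[OF l_pos _ \<Gamma>])
      fix j :: "real \<Rightarrow> real" assume j: "j \<in> circle_smooth l"
      then have "2 * G o0 g j = ?R j" using g by blast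
      then have "G o0 g j = G o0 ?\<Gamma> j" using \<Gamma>j[OF j] by linarith
      then show "ip g j = ip ?\<Gamma> j" using \<phi>l by (simp add: metric_chart_center)
    qed (use g in blast)
  qed
qed

lemma christoffel_combination:
  assumes "h \<in> circle_smooth l" "k \<in> circle_smooth l" "y \<in> circle_smooth l"
  shows "ip (christoffel \<phi> l c o0 h k) y =
      deriv \<phi> l * ip k \<kappa> / (2 * \<phi> l) * ip h y + deriv \<phi> l * ip h \<kappa> / (2 * \<phi> l) * ip k y
      + 1/2 * ip (\<lambda>\<theta>. \<kappa> \<theta> * (h \<theta> * k \<theta>)) y + (- deriv \<phi> l * ip h k / (2 * \<phi> l)) * ip \<kappa> y"
  unfolding christoffel_eq[OF assms(1,2)]
  by (intro circle_inner_combination_left continuous_intros circle_smoothD(2)[OF assms(1)]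
      circle_smoothD(2)[OF assms(2)] circle_smoothD(2)[OF assms(3)] \<kappa>_continuous)

lemma christoffel_circle_smooth:
  assumes "h \<in> circle_smooth l" "k \<in> circle_smooth l"
  shows "christoffel \<phi> l c o0 h k \<in> circle_smooth l"
  unfolding christoffel_eq[OF assms] by (intro circle_smooth_intros assms \<kappa>_circle_smooth)

lemma christoffel_combination_right:
  assumes "h \<in> circle_smooth l" "k \<in> circle_smooth l" "y \<in> circle_smooth l"
  shows "ip y (christoffel \<phi> l c o0 h k) =
      deriv \<phi> l * ip k \<kappa> / (2 * \<phi> l) * ip h y + deriv \<phi> l * ip h \<kappa> / (2 * \<phi> l) * ip k y
      + 1/2 * ip (\<lambda>\<theta>. \<kappa> \<theta> * (h \<theta> * k \<theta>)) y + (- deriv \<phi> l * ip h k / (2 * \<phi> l)) * ip \<kappa> y"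
  using christoffel_combination[OF assms] by (simp only: circle_inner_commute)

text \<open>
  With all integrals named the claim is an identity of rational functions. In \<open>G(\<Gamma>(h,m),\<Gamma>(h,m))\<close> and in
  \<open>G(\<Gamma>(m,m),\<Gamma>(h,h))\<close> the integrals \<open>X\<close>, \<open>P\<close> and \<open>Q\<close> have the same coefficients and cancel; in the second
  variations \<open>P\<close> and \<open>Q\<close> cancel among themselves.
\<close>

lemma sectional_curvature_eq:
  assumes m: "m \<in> circle_smooth l" and h: "h \<in> circle_smooth l"
    and mm: "\<phi> l * ip m m = 1" and hh: "\<phi> l * ip h h = 1" and mh: "ip m h = 0"
  shows "sectional_curvature \<phi> l c m h =
      \<phi> l / 2 * ip (\<lambda>\<theta>. deriv m \<theta> * h \<theta> - m \<theta> * deriv h \<theta>) (\<lambda>\<theta>. deriv m \<theta> * h \<theta> - m \<theta> * deriv h \<theta>)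
    - deriv \<phi> l / (2 * \<phi> l) * (ip (deriv m) (deriv m) + ip (deriv h) (deriv h))
    + deriv \<phi> l / (4 * \<phi> l) *
        (ip (\<lambda>\<theta>. m \<theta> * \<kappa> \<theta>) (\<lambda>\<theta>. m \<theta> * \<kappa> \<theta>) + ip (\<lambda>\<theta>. h \<theta> * \<kappa> \<theta>) (\<lambda>\<theta>. h \<theta> * \<kappa> \<theta>))
    + (3 * (deriv \<phi> l)\<^sup>2 - 2 * \<phi> l * deriv (deriv \<phi>) l) / (4 * (\<phi> l)\<^sup>2) *
        ((ip m \<kappa>)\<^sup>2 + (ip h \<kappa>)\<^sup>2)
    - (deriv \<phi> l)\<^sup>2 / (4 * (\<phi> l)^3) * ip \<kappa> \<kappa>"
proof -
  define p where "p = \<phi> l"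
  define d where "d = deriv \<phi> l"
  define dd where "dd = deriv (deriv \<phi>) l"
  define a where "a = ip m \<kappa>"
  define b where "b = ip h \<kappa>"
  define K where "K = ip \<kappa> \<kappa>"
  define P where "P = integral {0..l} (\<lambda>\<theta>. \<kappa> \<theta> * (h \<theta> * (h \<theta> * m \<theta>)))"
  define Q where "Q = integral {0..l} (\<lambda>\<theta>. \<kappa> \<theta> * (h \<theta> * (m \<theta> * m \<theta>)))"
  define X where "X = integral {0..l} (\<lambda>\<theta>. \<kappa> \<theta> * (\<kappa> \<theta> * (h \<theta> * (h \<theta> * (m \<theta> * m \<theta>)))))"
  define Km where "Km = ip (\<lambda>\<theta>. m \<theta> * \<kappa> \<theta>) (\<lambda>\<theta>. m \<theta> * \<kappa> \<theta>)"
  define Kh where "Kh = ip (\<lambda>\<theta>. h \<theta> * \<kappa> \<theta>) (\<lambda>\<theta>. h \<theta> * \<kappa> \<theta>)"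
  define M1 where "M1 = ip (deriv m) (deriv m)"
  define H1 where "H1 = ip (deriv h) (deriv h)"
  define Y where "Y = ip (\<lambda>\<theta>. deriv m \<theta> * deriv h \<theta>) (\<lambda>\<theta>. h \<theta> * m \<theta>)"
  define Zm where "Zm = ip (\<lambda>\<theta>. deriv m \<theta> * deriv m \<theta>) (\<lambda>\<theta>. h \<theta> * h \<theta>)"
  define Zh where "Zh = ip (\<lambda>\<theta>. deriv h \<theta> * deriv h \<theta>) (\<lambda>\<theta>. m \<theta> * m \<theta>)"
  have p: "p > 0" using \<phi>_pos l_pos by (simp add: p_def)
  have ips: "ip m m = 1 / p" "ip h h = 1 / p" "ip m h = 0" "ip h m = 0"
    "ip \<kappa> m = a" "ip \<kappa> h = b"
    using mm hh mh p by (simp_all add: p_def a_def b_def circle_inner_commute field_simps)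
  have cubic:
    "ip (\<lambda>\<theta>. \<kappa> \<theta> * (h \<theta> * m \<theta>)) h = P" "ip (\<lambda>\<theta>. \<kappa> \<theta> * (h \<theta> * m \<theta>)) m = Q"
    "ip (\<lambda>\<theta>. \<kappa> \<theta> * (h \<theta> * h \<theta>)) m = P" "ip (\<lambda>\<theta>. \<kappa> \<theta> * (m \<theta> * m \<theta>)) h = Q"
    "ip m (\<lambda>\<theta>. \<kappa> \<theta> * (h \<theta> * h \<theta>)) = P" "ip h (\<lambda>\<theta>. \<kappa> \<theta> * (m \<theta> * m \<theta>)) = Q"
    "ip h (\<lambda>\<theta>. \<kappa> \<theta> * (h \<theta> * m \<theta>)) = P" "ip m (\<lambda>\<theta>. \<kappa> \<theta> * (h \<theta> * m \<theta>)) = Q"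
    "ip (\<lambda>\<theta>. h \<theta> * \<kappa> \<theta>) (\<lambda>\<theta>. h \<theta> * m \<theta>) = P" "ip (\<lambda>\<theta>. m \<theta> * \<kappa> \<theta>) (\<lambda>\<theta>. h \<theta> * m \<theta>) = Q"
    "ip (\<lambda>\<theta>. m \<theta> * \<kappa> \<theta>) (\<lambda>\<theta>. h \<theta> * h \<theta>) = P" "ip (\<lambda>\<theta>. h \<theta> * \<kappa> \<theta>) (\<lambda>\<theta>. m \<theta> * m \<theta>) = Q"
    by (simp_all add: circle_inner_def P_def Q_def mult_ac)
  have quartic:
    "ip (\<lambda>\<theta>. \<kappa> \<theta> * (h \<theta> * m \<theta>)) (\<lambda>\<theta>. \<kappa> \<theta> * (h \<theta> * m \<theta>)) = X"
    "ip (\<lambda>\<theta>. \<kappa> \<theta> * (h \<theta> * h \<theta>)) (\<lambda>\<theta>. \<kappa> \<theta> * (m \<theta> * m \<theta>)) = X"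
    "ip (\<lambda>\<theta>. \<kappa> \<theta> * (m \<theta> * m \<theta>)) (\<lambda>\<theta>. \<kappa> \<theta> * (h \<theta> * h \<theta>)) = X"
    "ip (\<lambda>\<theta>. \<kappa> \<theta> * (m \<theta> * m \<theta>)) \<kappa> = Km" "ip \<kappa> (\<lambda>\<theta>. \<kappa> \<theta> * (m \<theta> * m \<theta>)) = Km"
    "ip (\<lambda>\<theta>. \<kappa> \<theta> * (h \<theta> * h \<theta>)) \<kappa> = Kh" "ip \<kappa> (\<lambda>\<theta>. \<kappa> \<theta> * (h \<theta> * h \<theta>)) = Kh"
    by (simp_all add: circle_inner_def X_def Km_def Kh_def mult_ac)
  note hm = circle_smooth_mult[OF \<kappa>_circle_smooth circle_smooth_mult[OF h m]]
    and sm = circle_smooth_mult[OF \<kappa>_circle_smooth circle_smooth_mult[OF m m]]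
    and sh = circle_smooth_mult[OF \<kappa>_circle_smooth circle_smooth_mult[OF h h]]
  note simps = christoffel_combination christoffel_combination_right christoffel_circle_smooth
    m h hm sm sh \<kappa>_circle_smooth ips cubic quartic a_def[symmetric] b_def[symmetric] K_def[symmetric]
    p_def[symmetric] d_def[symmetric] metric_chart_center
  let ?\<Gamma> = "christoffel \<phi> l c o0"
  have \<Gamma>hm: "G o0 (?\<Gamma> h m) (?\<Gamma> h m) =
      (p\<^sup>2 * X + d\<^sup>2 * (a\<^sup>2 + b\<^sup>2) / p + 2 * p * d * (a * P + b * Q)) / (4 * p)"
    using p by (simp add: simps) (simp add: field_simps power2_eq_square)
  have \<Gamma>\<Gamma>: "G o0 (?\<Gamma> m m) (?\<Gamma> h h) =
      (p\<^sup>2 * X - d * (Km + Kh) + d\<^sup>2 * K / p\<^sup>2 - 2 * d\<^sup>2 * (a\<^sup>2 + b\<^sup>2) / p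
        + 2 * p * d * (a * P + b * Q)) / (4 * p)"
    using p by (simp add: simps) (simp add: field_simps power2_eq_square)
  note sv = second_variation[OF circle_smoothD(1) circle_smoothD(1) circle_smoothD(1) circle_smoothD(1)]
  have Dmh: "dir_deriv m (dir_deriv h (\<lambda>f. G f h m)) o0 = d * (a * P + b * Q) - p * Y"
    by (simp add: sv[OF m h h m] simps Y_def)
  have Dmm: "dir_deriv m (dir_deriv m (\<lambda>f. G f h h)) o0
      = (d * M1 + dd * a\<^sup>2) / p + 2 * d * a * P - p * Zm"
    by (simp add: sv[OF m m h h] simps Zm_def M1_def dd_def power2_eq_square)
  have Dhh: "dir_deriv h (dir_deriv h (\<lambda>f. G f m m)) o0
      = (d * H1 + dd * b\<^sup>2) / p + 2 * d * b * Q - p * Zh"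
    by (simp add: sv[OF h h m m] simps Zh_def H1_def dd_def power2_eq_square)
  have W: "ip (\<lambda>\<theta>. deriv m \<theta> * h \<theta> - m \<theta> * deriv h \<theta>) (\<lambda>\<theta>. deriv m \<theta> * h \<theta> - m \<theta> * deriv h \<theta>)
      = Zm + Zh - 2 * Y"
  proof -
    have cont: "continuous_on {0..l} m" "continuous_on {0..l} h"
      "continuous_on {0..l} (deriv m)" "continuous_on {0..l} (deriv h)"
      using circle_smoothD(1)[OF m] circle_smoothD(1)[OF h]
      by (simp_all add: smooth_on_continuous smooth_on_deriv)
    have "integral {0..l} (\<lambda>\<theta>. (deriv m \<theta> * deriv m \<theta>) * (h \<theta> * h \<theta>)
          + (deriv h \<theta> * deriv h \<theta>) * (m \<theta> * m \<theta>) - 2 * ((deriv m \<theta> * deriv h \<theta>) * (h \<theta> * m \<theta>)))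
        = Zm + Zh - 2 * Y"
      unfolding Zm_def Zh_def Y_def circle_inner_def integral_mult_right[symmetric]
      by (simp only: integral_add[symmetric] integral_diff[symmetric] integrable_continuous_real
          continuous_intros cont)
    then show ?thesis by (simp add: circle_inner_def algebra_simps)
  qed
  show ?thesis
    unfolding sectional_curvature_def Let_def \<Gamma>hm \<Gamma>\<Gamma> Dmh Dmm Dhh W
    unfolding p_def[symmetric] d_def[symmetric] dd_def[symmetric] a_def[symmetric] b_def[symmetric]
      K_def[symmetric] Km_def[symmetric] Kh_def[symmetric] M1_def[symmetric] H1_def[symmetric]
    using p by (simp add: field_simps power2_eq_square power3_eq_cube)
qed

end

theorem mainTheorem4:
  fixes \<phi> :: "real \<Rightarrow> real" and l :: real and c :: "real \<Rightarrow> complex" and m h :: "real \<Rightarrow> real"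
  assumes "smooth_on {0<..} \<phi>" and "\<And>x. x > 0 \<Longrightarrow> \<phi> x > 0"
    and "l > 0"
    and "free_immersion l c" and "arclength_param c"
    and "m \<in> circle_smooth l" and "h \<in> circle_smooth l"
    and "\<phi> l * (circle_norm l m)\<^sup>2 = 1" and "\<phi> l * (circle_norm l h)\<^sup>2 = 1"
    and "circle_inner l m h = 0"
  shows "sectional_curvature \<phi> l c m h =
      \<phi> l / 2 * (circle_norm l (\<lambda>\<theta>. deriv m \<theta> * h \<theta> - m \<theta> * deriv h \<theta>))\<^sup>2
    - deriv \<phi> l / (2 * \<phi> l) * ((circle_norm l (deriv m))\<^sup>2 + (circle_norm l (deriv h))\<^sup>2)
    + deriv \<phi> l / (4 * \<phi> l) *
        ((circle_norm l (\<lambda>\<theta>. m \<theta> * curvature c \<theta>))\<^sup>2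
         + (circle_norm l (\<lambda>\<theta>. h \<theta> * curvature c \<theta>))\<^sup>2)
    + (3 * (deriv \<phi> l)\<^sup>2 - 2 * \<phi> l * deriv (deriv \<phi>) l) / (4 * (\<phi> l)\<^sup>2) *
        ((circle_inner l m (curvature c))\<^sup>2 + (circle_inner l h (curvature c))\<^sup>2)
    - (deriv \<phi> l)\<^sup>2 / (4 * (\<phi> l)^3) * (circle_norm l (curvature c))\<^sup>2"
proof -
  interpret arclength_curve \<phi> l c
    by unfold_locales
      (use assms(1-5) in \<open>auto simp: free_immersion_def immersion_def\<close>)
  note m = circle_smoothD[OF assms(6)] and h = circle_smoothD[OF assms(7)]
  have dm: "continuous_on {0..l} (deriv m)" and dh: "continuous_on {0..l} (deriv h)"
    using m(1) h(1) by (simp_all add: smooth_on_continuous smooth_on_deriv)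
  note norms = circle_norm_square[OF m(2)] circle_norm_square[OF h(2)]
    circle_norm_square[OF dm] circle_norm_square[OF dh] circle_norm_square[OF \<kappa>_continuous]
    circle_norm_square[OF continuous_on_mult[OF m(2) \<kappa>_continuous]]
    circle_norm_square[OF continuous_on_mult[OF h(2) \<kappa>_continuous]]
    circle_norm_square[OF continuous_on_diff[OF continuous_on_mult[OF dm h(2)]
        continuous_on_mult[OF m(2) dh]]]
  show ?thesis
    unfolding norms
    by (rule sectional_curvature_eq) (use assms(6-10) in \<open>simp_all add: norms\<close>)
qed

end
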